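(* Let $r$ be a ray in $\mathbb{H}$ (half-infinite geodesic) starting at $i$ and containing some other point of $\mathcal{L}$. Then there exists $\gamma\in\mathrm{SL}_2(\mathbb{Z})$ such that $$r\cap \mathcal{L}^*=\big\{(\gamma\gamma^t)^{n-1}\gamma(i): n\in \mathbb{Z}^+\big\}\cup\big\{(\gamma\gamma^t)^{n}(i): n\in \mathbb{Z}^+\big\}.$$ Moreover $\gamma(i)$ is visible, and the points of $r\cap\mathcal{L}$ are equally spaced on $r$ (with respect to hyperbolic distance).
   Context: $\mathbb{H}$ is the upper half-plane with the Poincaré metric $ds^2=y^{-2}(dx^2+dy^2)$; $\mathrm{SL}_2(\mathbb{Z})$ acts on it by fractional linear transformations. $\gamma^t$ is the transpose matrix of $\gamma$, and $\mathbb{Z}^+$ is the set of positive integers. $\mathcal{L}=\{\gamma(i):\gamma\in \mathrm{SL}_2(\mathbb{Z})\}$ is the orbit of $i$ and $\mathcal{L}^*=\mathcal{L}\setminus\{i\}$. A point $z\in\mathcal{L}$, $z\neq i$, is visible if the geodesic arc connecting $i$ and $z$ contains no point of $\mathcal{L}$ other than $i$ and $z$. *)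

theory Defs
  imports "HOL-Analysis.Analysis"
begin

definition upper_half_plane :: "complex set" where
  "upper_half_plane = {z. 0 < Im z}"

(* The Riemannian distance of ds^2 = y^(-2) (dx^2 + dy^2): the infimum of the lengths of
   piecewise C1 paths.  A valid_path may have an unbounded derivative near its finitely many
   exceptional points, so only paths whose length integral exists are admitted; the total
   operator "integral" would give the others length 0. *)
definition hyp_dist :: "complex \<Rightarrow> complex \<Rightarrow> real" where
  "hyp_dist z w = Inf {l. \<exists>g. valid_path g \<and> path_image g \<subseteq> upper_half_plane \<and>
      pathstart g = z \<and> pathfinish g = w \<and>
      ((\<lambda>t. norm (vector_derivative g (at t within {0..1})) / Im (g t)) has_integral l) {0..1}}"

(* Geodesics are parametrised by arc length: in the hyperbolic plane every geodesic is
   globally distance-minimising, so these are the isometric embeddings of intervals. *)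
definition hyp_geodesic_on :: "real set \<Rightarrow> (real \<Rightarrow> complex) \<Rightarrow> bool" where
  "hyp_geodesic_on I c \<longleftrightarrow> c ` I \<subseteq> upper_half_plane \<and>
     (\<forall>s\<in>I. \<forall>t\<in>I. hyp_dist (c s) (c t) = \<bar>s - t\<bar>)"

definition geodesic_ray_from :: "complex \<Rightarrow> complex set \<Rightarrow> bool" where
  "geodesic_ray_from z r \<longleftrightarrow> (\<exists>c. hyp_geodesic_on {0..} c \<and> c 0 = z \<and> r = c ` {0..})"

definition geodesic_arc :: "complex \<Rightarrow> complex \<Rightarrow> complex set \<Rightarrow> bool" where
  "geodesic_arc z w A \<longleftrightarrow>
     (\<exists>c l. 0 \<le> l \<and> hyp_geodesic_on {0..l} c \<and> c 0 = z \<and> c l = w \<and> A = c ` {0..l})"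

definition SL2Z :: "(int^2^2) set" where
  "SL2Z = {\<gamma>. det \<gamma> = 1}"

definition act :: "int^2^2 \<Rightarrow> complex \<Rightarrow> complex" where
  "act \<gamma> = moebius (of_int (\<gamma>$1$1)) (of_int (\<gamma>$1$2)) (of_int (\<gamma>$2$1)) (of_int (\<gamma>$2$2))"

(* Power for the matrix product; the overloaded (^) on vectors of vectors is entrywise. *)
primrec matrix_pow :: "int^2^2 \<Rightarrow> nat \<Rightarrow> int^2^2" where
  "matrix_pow A 0 = mat 1"
| "matrix_pow A (Suc n) = A ** matrix_pow A n"

definition orbit_i :: "complex set" where
  "orbit_i = {act \<gamma> \<i> | \<gamma>. \<gamma> \<in> SL2Z}"

(* The geodesic arc from i to z exists and is unique, so "the arc" is rendered by "an arc". *)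
definition visible :: "complex \<Rightarrow> bool" where
  "visible z \<longleftrightarrow> z \<in> orbit_i \<and> z \<noteq> \<i> \<and>
     (\<exists>A. geodesic_arc \<i> z A \<and> A \<inter> orbit_i = {\<i>, z})"

(* For an infinite subset of a geodesic ray: the points can be listed so that the distance
   between the m-th and the n-th is |m - n| times a fixed positive spacing.  Requiring this
   for all m and n, not just neighbours, makes the list run in order along the ray. *)
definition equally_spaced :: "complex set \<Rightarrow> bool" where
  "equally_spaced X \<longleftrightarrow> (\<exists>d>0. \<exists>p :: nat \<Rightarrow> complex. X = range p \<and>
     (\<forall>m n. hyp_dist (p m) (p n) = \<bar>real m - real n\<bar> * d))"

end

theory Submission
  imports Defs
begin

text \<open>
  Let $\gamma(i)$ be the orbit point on the ray that is closest to $i$, at distance $l$. It exists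
  because $2 \cosh d(i, \gamma(i))$ is the sum of the squares of the entries of $\gamma$, an integer
  (\<open>cosh_hyp_dist_act\<close>), and it is visible by its choice.

  The matrix $\gamma\gamma^t$ is, up to sign, the product of the half turns about $\gamma(i)$ and
  about $i$, so it translates the line carrying the ray by $2l$. This is proved by diagonalising it
  (\<open>translation_along_line\<close>). Applied repeatedly to $i$ and to $\gamma(i)$ it yields orbit points at
  all distances $nl$ along the ray. There are no others: the half turn about $i$ also belongs to the
  modular group, so the set of positions of orbit points on the full line is closed under negation
  and under shifts by $2l$, and by the choice of $l$ it does not meet the open interval from $0$ to
  $l$ (\<open>multiples_of_least_positive\<close>).

  Distances and geodesics are given metrically, so coordinates have to be recovered first. Invariance
  under real fractional linear maps and a computation on the imaginary axis give
  $\cosh d(z, w) = 1 + |z - w|^2 / (2\, \mathrm{Im}\, z\, \mathrm{Im}\, w)$ (\<open>cosh_hyp_dist\<close>). By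
  this formula a point is determined by its distances to $i$ and to one other point of the line in
  the way required of a geodesic (\<open>point_determined_by_distances\<close>), so every geodesic ray from $i$ is
  half of a rotated copy of the imaginary axis (\<open>geodesic_ray_is_line_through_i\<close>).
\<close>

section \<open>Real fractional linear transformations\<close>

definition real_act :: "real^2^2 \<Rightarrow> complex \<Rightarrow> complex" where
  "real_act M = moebius (of_real (M$1$1)) (of_real (M$1$2)) (of_real (M$2$1)) (of_real (M$2$2))"

text \<open>The classical factor of automorphy $cz + d$. Dividing by its powers and products turns imaginary
  parts and differences of points into those of their images.\<close>

definition cocycle :: "real^2^2 \<Rightarrow> complex \<Rightarrow> complex" where
  "cocycle M z = of_real (M$2$1) * z + of_real (M$2$2)"

lemma real_act_eq:
  "real_act M z = (of_real (M$1$1) * z + of_real (M$1$2)) / cocycle M z"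
  by (simp add: real_act_def moebius_def cocycle_def)

lemma cocycle_nonzero:
  assumes "det M = 1" "Im z > 0"
  shows "cocycle M z \<noteq> 0"
proof
  assume *: "cocycle M z = 0"
  have "Im (cocycle M z) = M$2$1 * Im z" "Re (cocycle M z) = M$2$1 * Re z + M$2$2"
    by (simp_all add: cocycle_def)
  with * assms(2) have "M$2$1 = 0" "M$2$2 = 0"
    by auto
  with assms(1) show False
    by (simp add: det_2)
qed

lemma Im_real_act:
  assumes "det M = 1"
  shows "Im (real_act M z) = Im z / (cmod (cocycle M z))\<^sup>2"
proof -
  have "Im z * (M$1$1 * M$2$2 - M$1$2 * M$2$1) = Im z"
    using assms by (simp add: det_2)
  then show ?thesis
    unfolding real_act_eq Im_divide cmod_power2
    by (intro arg_cong2[where f = "(/)"]) (auto simp: cocycle_def algebra_simps)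
qed

lemma Im_real_act_pos:
  assumes "det M = 1" "Im z > 0"
  shows "Im (real_act M z) > 0"
  using assms by (simp add: Im_real_act cocycle_nonzero)

lemma real_act_mult:
  assumes "det B = 1" "Im z > 0"
  shows "real_act (A ** B) z = real_act A (real_act B z)"
proof -
  have nz: "cocycle B z \<noteq> 0"
    using assms by (rule cocycle_nonzero)
  have co: "cocycle (A ** B) z = cocycle A (real_act B z) * cocycle B z"
    using nz unfolding real_act_eq cocycle_def[of A]
    by (simp add: field_simps) (simp add: cocycle_def matrix_matrix_mult_def sum_2 algebra_simps)
  have "real_act A (real_act B z) =
      ((of_real (A$1$1) * real_act B z + of_real (A$1$2)) * cocycle B z) / cocycle (A ** B) z"
    using nz by (simp add: co real_act_eq[of A])
  also have "(of_real (A$1$1) * real_act B z + of_real (A$1$2)) * cocycle B z =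
      of_real ((A ** B)$1$1) * z + of_real ((A ** B)$1$2)"
    using nz unfolding real_act_eq
    by (simp add: field_simps) (simp add: cocycle_def matrix_matrix_mult_def sum_2 algebra_simps)
  finally show ?thesis
    by (simp add: real_act_eq)
qed

lemma real_act_one [simp]: "real_act (mat 1) z = z"
  by (simp add: real_act_eq cocycle_def mat_def)

lemma real_act_diff:
  assumes "det M = 1" "Im z > 0" "Im w > 0"
  shows "real_act M z - real_act M w = (z - w) / (cocycle M z * cocycle M w)"
proof -
  have nz: "cocycle M z \<noteq> 0" "cocycle M w \<noteq> 0"
    using assms cocycle_nonzero by blast+
  have "of_real (M$1$1 * M$2$2 - M$1$2 * M$2$1) = (1::complex)"
    using assms(1) by (simp add: det_2)
  then have "(of_real (M$1$1) * z + of_real (M$1$2)) * cocycle M w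
      - (of_real (M$1$1) * w + of_real (M$1$2)) * cocycle M z = z - w"
    unfolding cocycle_def of_real_diff of_real_mult by algebra
  with nz show ?thesis
    by (simp add: real_act_eq diff_frac_eq)
qed

lemma has_field_derivative_real_act:
  assumes "det M = 1" "Im z > 0"
  shows "(real_act M has_field_derivative 1 / (cocycle M z)\<^sup>2) (at z)"
proof -
  have nz: "cocycle M z \<noteq> 0"
    using assms by (rule cocycle_nonzero)
  have "of_real (M$1$1 * M$2$2 - M$1$2 * M$2$1) = (1::complex)"
    using assms(1) by (simp add: det_2)
  then have "of_real (M$1$1) * cocycle M z
      - (of_real (M$1$1) * z + of_real (M$1$2)) * of_real (M$2$1) = 1"
    unfolding cocycle_def of_real_diff of_real_mult by algebra
  moreover have "((\<lambda>z. (of_real (M$1$1) * z + of_real (M$1$2)) / cocycle M z) has_field_derivative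
      (of_real (M$1$1) * cocycle M z
        - (of_real (M$1$1) * z + of_real (M$1$2)) * of_real (M$2$1)) / (cocycle M z * cocycle M z)) (at z)"
    using nz unfolding cocycle_def by (auto intro!: derivative_eq_intros)
  ultimately show ?thesis
    by (simp add: real_act_eq[abs_def] power2_eq_square)
qed

lemma real_act_inverse:
  assumes "det M = 1"
  obtains N where "det N = 1" "\<And>z. Im z > 0 \<Longrightarrow> real_act N (real_act M z) = z"
proof
  define N :: "real^2^2" where "N = vector [vector [M$2$2, - M$1$2], vector [- M$2$1, M$1$1]]"
  show "det N = 1"
    using assms by (simp add: N_def det_2 mult.commute)
  have "N ** M = mat 1"
    using assms
    by (simp add: N_def vec_eq_iff forall_2 matrix_matrix_mult_def sum_2 mat_def det_2 mult.commute)
  then show "real_act N (real_act M z) = z" if "Im z > 0" for z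
    using real_act_mult[OF assms that, of N] by simp
qed

section \<open>Invariance of the hyperbolic distance\<close>

definition path_lengths :: "complex \<Rightarrow> complex \<Rightarrow> real set" where
  "path_lengths z w = {l. \<exists>g. valid_path g \<and> path_image g \<subseteq> upper_half_plane \<and>
      pathstart g = z \<and> pathfinish g = w \<and>
      ((\<lambda>t. norm (vector_derivative g (at t within {0..1})) / Im (g t)) has_integral l) {0..1}}"

text \<open>Along an image path the speed and the imaginary part are both divided by $|cz + d|^2$, so the
  integrand of the length is unchanged.\<close>

lemma path_lengths_real_act_subset:
  assumes "det M = 1"
  shows "path_lengths z w \<subseteq> path_lengths (real_act M z) (real_act M w)"
proof
  fix l assume "l \<in> path_lengths z w"
  then obtain g where g: "valid_path g" "path_image g \<subseteq> upper_half_plane"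
      "pathstart g = z" "pathfinish g = w"
    and l: "((\<lambda>t. norm (vector_derivative g (at t within {0..1})) / Im (g t)) has_integral l) {0..1}"
    by (auto simp: path_lengths_def)
  define h where "h = real_act M \<circ> g"
  have pos: "Im (g t) > 0" if "t \<in> {0..1}" for t
    using g(2) that unfolding path_image_def upper_half_plane_def by blast
  have pos': "Im x > 0" if "x \<in> path_image g" for x
    using g(2) that by (auto simp: upper_half_plane_def)
  have deriv: "deriv (real_act M) x = 1 / (cocycle M x)\<^sup>2" if "Im x > 0" for x
    using has_field_derivative_real_act[OF assms that] by (rule DERIV_imp_deriv)
  have fd: "real_act M field_differentiable at x" if "Im x > 0" for x
    using has_field_derivative_real_act[OF assms that] by (auto simp: field_differentiable_def)
  have "continuous_on (path_image g) (\<lambda>x. 1 / (cocycle M x)\<^sup>2)"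
    using cocycle_nonzero[OF assms pos'] unfolding cocycle_def by (auto intro!: continuous_intros)
  then have "continuous_on (path_image g) (deriv (real_act M))"
    by (rule continuous_on_eq) (simp add: deriv pos')
  then have valid: "valid_path h"
    unfolding h_def using g(1) pos' by (intro valid_path_compose fd)
  have image: "path_image h \<subseteq> upper_half_plane"
    using pos Im_real_act_pos[OF assms] by (auto simp: h_def path_image_def upper_half_plane_def)
  obtain S where S: "finite S" "g C1_differentiable_on {0..1} - S"
    using g(1) unfolding valid_path_def piecewise_C1_differentiable_on_def by auto
  have "norm (vector_derivative h (at t within {0..1})) / Im (h t) =
      norm (vector_derivative g (at t within {0..1})) / Im (g t)"
    if t: "t \<in> {0..1} - (S \<union> {0, 1})" for t
  proof -
    have at: "at t within {0..1} = at t"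
      using t by (intro at_within_interior) auto
    have "g differentiable at t"
      using S t by (auto simp: C1_differentiable_on_eq)
    then have "vector_derivative h (at t) = vector_derivative g (at t) * deriv (real_act M) (g t)"
      unfolding h_def using pos[of t] t by (intro vector_derivative_chain_at_general fd) auto
    moreover have "cocycle M (g t) \<noteq> 0" "Im (g t) > 0"
      using pos[of t] t cocycle_nonzero[OF assms] by auto
    ultimately show ?thesis
      by (simp add: at h_def Im_real_act[OF assms] deriv norm_mult norm_divide norm_power)
  qed
  then have "((\<lambda>t. norm (vector_derivative h (at t within {0..1})) / Im (h t)) has_integral l) {0..1}"
    using l S(1) by (intro has_integral_spike_finite[OF _ _ l, of "S \<union> {0, 1}"]) auto
  with valid image g show "l \<in> path_lengths (real_act M z) (real_act M w)"
    unfolding path_lengths_def by (auto simp: h_def pathstart_def pathfinish_def)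
qed

lemma hyp_dist_real_act:
  assumes "det M = 1" "Im z > 0" "Im w > 0"
  shows "hyp_dist (real_act M z) (real_act M w) = hyp_dist z w"
proof -
  obtain N where "det N = 1" "\<And>z. Im z > 0 \<Longrightarrow> real_act N (real_act M z) = z"
    using real_act_inverse[OF assms(1)] by blast
  then have "path_lengths (real_act M z) (real_act M w) \<subseteq> path_lengths z w"
    using path_lengths_real_act_subset[of N "real_act M z" "real_act M w"] assms by simp
  then have "path_lengths (real_act M z) (real_act M w) = path_lengths z w"
    using path_lengths_real_act_subset[OF assms(1)] by blast
  then show ?thesis
    by (simp add: hyp_dist_def path_lengths_def)
qed

section \<open>An explicit formula for the distance\<close>

text \<open>The function $\log \circ \mathrm{Im}$ has derivative $\mathrm{Im}\,g' / \mathrm{Im}\,g$ along a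
  path $g$, which the length integrand dominates; the fundamental theorem of calculus gives the
  rest. Finitely many corners do no harm because $\log \circ \mathrm{Im} \circ g$ is continuous.\<close>

lemma abs_ln_le_path_length:
  assumes "l \<in> path_lengths z w" "Im z > 0" "Im w > 0"
  shows "\<bar>ln (Im w) - ln (Im z)\<bar> \<le> l"
proof -
  obtain g where g: "valid_path g" "path_image g \<subseteq> upper_half_plane"
      "pathstart g = z" "pathfinish g = w"
    and l: "((\<lambda>t. norm (vector_derivative g (at t within {0..1})) / Im (g t)) has_integral l) {0..1}"
    using assms(1) by (auto simp: path_lengths_def)
  have pos: "Im (g t) > 0" if "t \<in> {0..1}" for t
    using g(2) that unfolding path_image_def upper_half_plane_def by blast
  obtain S where S: "finite S" "g C1_differentiable_on {0..1} - S"
    using g(1) unfolding valid_path_def piecewise_C1_differentiable_on_def by auto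
  have "continuous_on {0..1} g"
    using valid_path_imp_path[OF g(1)] by (simp add: path_def)
  then have cont: "continuous_on {0..1} (\<lambda>t. ln (Im (g t)))"
    using pos by (fastforce intro!: continuous_intros)
  let ?g' = "\<lambda>t. vector_derivative g (at t within {0..1})"
  have "((\<lambda>t. Im (?g' t) / Im (g t)) has_integral (ln (Im (g 1)) - ln (Im (g 0)))) {0..1}"
  proof (rule fundamental_theorem_of_calculus_interior_strong[OF S(1) _ _ cont])
    fix t :: real assume t: "t \<in> {0<..<1} - S"
    have at: "at t within {0..1} = at t"
      using t by (intro at_within_interior) auto
    have "g differentiable at t"
      using S t by (auto simp: C1_differentiable_on_eq)
    then have "(g has_vector_derivative ?g' t) (at t)"
      unfolding at by (simp add: vector_derivative_works)
    then have "((\<lambda>t. Im (g t)) has_vector_derivative Im (?g' t)) (at t)"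
      by (rule bounded_linear.has_vector_derivative[OF bounded_linear_Im])
    then have "((\<lambda>t. Im (g t)) has_real_derivative Im (?g' t)) (at t)"
      by (simp add: has_real_derivative_iff_has_vector_derivative)
    then have "((\<lambda>t. ln (Im (g t))) has_real_derivative Im (?g' t) / Im (g t)) (at t)"
      using DERIV_chain2[where f = ln, OF DERIV_ln_divide] pos[of t] t by simp
    then show "((\<lambda>t. ln (Im (g t))) has_vector_derivative Im (?g' t) / Im (g t)) (at t)"
      by (simp add: has_real_derivative_iff_has_vector_derivative)
  qed simp
  moreover have "g 0 = z" "g 1 = w"
    using g by (auto simp: pathstart_def pathfinish_def)
  ultimately have I: "((\<lambda>t. Im (?g' t) / Im (g t)) has_integral (ln (Im w) - ln (Im z))) {0..1}"
    by simp
  have bound: "\<bar>Im (?g' t) / Im (g t)\<bar> \<le> norm (?g' t) / Im (g t)" if "t \<in> {0..1}" for t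
    using pos[OF that] abs_Im_le_cmod[of "?g' t"] by (simp add: abs_divide divide_right_mono)
  have "ln (Im w) - ln (Im z) \<le> l"
    by (rule has_integral_le[OF I l]) (rule order_trans[OF abs_ge_self bound])
  moreover have "- (ln (Im w) - ln (Im z)) \<le> l"
    by (rule has_integral_le[OF has_integral_neg[OF I] l]) (rule order_trans[OF abs_ge_minus_self bound])
  ultimately show ?thesis
    by linarith
qed

text \<open>The bound of the preceding lemma is attained by the vertical segment, so it is the distance.\<close>

lemma abs_ln_in_path_lengths:
  assumes "y > 0"
  shows "\<bar>ln y\<bar> \<in> path_lengths \<i> (of_real y * \<i>)"
proof -
  define g where "g = linepath \<i> (of_real y * \<i>)"
  have Im_g: "Im (g t) = 1 + t * (y - 1)" for t
    by (simp add: g_def linepath_def algebra_simps)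
  have pos: "1 + t * (y - 1) > 0" if "t \<in> {0..1}" for t
  proof -
    have "0 < (1 - t) + t * y"
      using that assms by (cases "t = 0") (auto intro: add_nonneg_pos)
    then show ?thesis
      by (simp add: algebra_simps)
  qed
  have speed: "norm (vector_derivative g (at t within {0..1})) = \<bar>y - 1\<bar>" if "t \<in> {0..1}" for t
  proof -
    have "(g has_vector_derivative (of_real y * \<i> - \<i>)) (at t within {0..1})"
      unfolding g_def by (rule has_vector_derivative_linepath_within)
    then have "vector_derivative g (at t within {0..1}) = of_real (y - 1) * \<i>"
      using vector_derivative_within_cbox[of 0 1 t g] that by (simp add: algebra_simps)
    then show ?thesis
      by (simp only: norm_mult norm_of_real) simp
  qed
  \<comment> \<open>The speed $|y - 1|$ is written as $\mathrm{sgn}(y-1)\,(y-1)$, which treats upward and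
    downward segments together.\<close>
  have "((\<lambda>t. sgn (y - 1) * ((y - 1) / (1 + t * (y - 1)))) has_integral
      sgn (y - 1) * (ln (1 + 1 * (y - 1)) - ln (1 + 0 * (y - 1)))) {0..1}"
  proof (intro has_integral_mult_right fundamental_theorem_of_calculus)
    fix t :: real assume "t \<in> {0..1}"
    then show "((\<lambda>t. ln (1 + t * (y - 1))) has_vector_derivative (y - 1) / (1 + t * (y - 1)))
        (at t within {0..1})"
      using pos[of t] unfolding has_real_derivative_iff_has_vector_derivative[symmetric]
      by (auto intro!: derivative_eq_intros)
  qed simp
  moreover have "sgn (y - 1) * (ln (1 + 1 * (y - 1)) - ln (1 + 0 * (y - 1))) = \<bar>ln y\<bar>"
    using assms by (auto simp: sgn_if abs_if)
  ultimately have "((\<lambda>t. sgn (y - 1) * ((y - 1) / (1 + t * (y - 1)))) has_integral \<bar>ln y\<bar>) {0..1}"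
    by simp
  then have "((\<lambda>t. norm (vector_derivative g (at t within {0..1})) / Im (g t)) has_integral \<bar>ln y\<bar>) {0..1}"
    by (rule has_integral_eq[rotated]) (simp add: speed Im_g abs_sgn mult.commute)
  moreover have "path_image g \<subseteq> upper_half_plane"
    using pos by (auto simp: path_image_def upper_half_plane_def Im_g)
  ultimately show ?thesis
    unfolding path_lengths_def by (auto intro!: exI[of _ g] simp: g_def)
qed

lemma hyp_dist_vertical:
  assumes "y > 0"
  shows "hyp_dist \<i> (of_real y * \<i>) = \<bar>ln y\<bar>"
proof -
  have "Inf (path_lengths \<i> (of_real y * \<i>)) = \<bar>ln y\<bar>"
    using abs_ln_in_path_lengths[OF assms] abs_ln_le_path_length[of _ \<i> "of_real y * \<i>"] assms
    by (intro cInf_eq_minimum) auto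
  then show ?thesis
    by (simp add: hyp_dist_def path_lengths_def)
qed

text \<open>Both sides of the distance formula are invariant, so it may be checked after moving the two
  points to a convenient position.\<close>

lemma cosh_hyp_dist_real_act_iff:
  assumes "det M = 1" "Im z > 0" "Im w > 0"
  shows "cosh (hyp_dist (real_act M z) (real_act M w)) =
           1 + (cmod (real_act M z - real_act M w))\<^sup>2 / (2 * Im (real_act M z) * Im (real_act M w))
         \<longleftrightarrow> cosh (hyp_dist z w) = 1 + (cmod (z - w))\<^sup>2 / (2 * Im z * Im w)"
proof -
  have "cocycle M z \<noteq> 0" "cocycle M w \<noteq> 0"
    using assms cocycle_nonzero by blast+
  then have "(cmod (real_act M z - real_act M w))\<^sup>2 / (2 * Im (real_act M z) * Im (real_act M w)) =
      (cmod (z - w))\<^sup>2 / (2 * Im z * Im w)"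
    by (simp add: real_act_diff Im_real_act assms norm_divide norm_mult power_divide power_mult_distrib)
  then show ?thesis
    by (simp add: hyp_dist_real_act assms)
qed

text \<open>On the half-plane this is the hyperbolic rotation about $i$ by the angle $-2\theta$.\<close>

definition rotation :: "real \<Rightarrow> real^2^2" where
  "rotation \<theta> = vector [vector [cos \<theta>, - sin \<theta>], vector [sin \<theta>, cos \<theta>]]"

lemma det_rotation [simp]: "det (rotation \<theta>) = 1"
  by (simp add: rotation_def det_2 power2_eq_square[symmetric])

lemma transpose_rotation: "transpose (rotation \<theta>) = rotation (- \<theta>)"
  by (simp add: rotation_def transpose_def vec_eq_iff forall_2)

lemma rotation_add: "rotation \<theta> ** rotation \<phi> = rotation (\<theta> + \<phi>)"
  by (simp add: rotation_def vec_eq_iff forall_2 matrix_matrix_mult_def sum_2 cos_add sin_add)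

lemma rotation_zero: "rotation 0 = mat 1"
  by (simp add: rotation_def vec_eq_iff forall_2 mat_def)

lemma real_act_rotation_add:
  assumes "Im z > 0"
  shows "real_act (rotation \<theta>) (real_act (rotation \<phi>) z) = real_act (rotation (\<theta> + \<phi>)) z"
  using real_act_mult[OF det_rotation assms, of "rotation \<theta>" \<phi>] by (simp add: rotation_add)

lemma rotation_fixes_i [simp]: "real_act (rotation \<theta>) \<i> = \<i>"
proof -
  have "cocycle (rotation \<theta>) \<i> \<noteq> 0"
    by (rule cocycle_nonzero) simp_all
  then show ?thesis
    by (simp add: real_act_eq cocycle_def rotation_def field_simps)
qed

lemma real_act_half_turn: "real_act (rotation (pi / 2)) z = - 1 / z"
  by (simp add: real_act_eq cocycle_def rotation_def)

text \<open>The real part of the image of $w$ under the rotation by $\theta$ is, up to a positive factor, a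
  linear combination of $\sin 2\theta$ and $\cos 2\theta$, so it vanishes for some $\theta$. A
  further half turn about $i$ replaces $y$ by $1/y$.\<close>

lemma rotate_to_imaginary_axis:
  assumes "Im w > 0"
  obtains \<theta> y where "y \<ge> 1" "real_act (rotation \<theta>) w = of_real y * \<i>"
proof -
  define A where "A = (cmod w)\<^sup>2 - 1"
  define B where "B = 2 * Re w"
  define D where "D = sqrt (A\<^sup>2 + B\<^sup>2)"
  obtain \<phi> where \<phi>: "sin \<phi> * A + cos \<phi> * B = 0"
  proof (cases "D = 0")
    case True
    then have "A = 0" "B = 0"
      by (auto simp: D_def)
    then show ?thesis
      using that by simp
  next
    case False
    moreover have "A = 0 \<longrightarrow> B \<noteq> 0"
      using False by (auto simp: D_def)
    moreover have "D\<^sup>2 = A\<^sup>2 + B\<^sup>2"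
      by (simp add: D_def)
    ultimately have "(A / D)\<^sup>2 + (- B / D)\<^sup>2 = 1"
      by (simp add: power_divide add_divide_distrib[symmetric])
    then obtain t where "A / D = cos t" "- B / D = sin t"
      using sincos_total_2pi by metis
    then have "sin t * A + cos t * B = 0"
      using False by (simp add: field_simps flip: \<open>A / D = cos t\<close> \<open>- B / D = sin t\<close>)
    then show ?thesis
      using that by blast
  qed
  \<comment> \<open>The condition obtained is one on the doubled angle.\<close>
  define \<theta> where "\<theta> = \<phi> / 2"
  define y where "y = Im (real_act (rotation \<theta>) w)"
  have "y > 0"
    unfolding y_def using assms by (intro Im_real_act_pos) simp_all
  have "\<phi> = 2 * \<theta>"
    by (simp add: \<theta>_def)
  with \<phi> have zero: "2 * (cos \<theta> * sin \<theta> * ((cmod w)\<^sup>2 - 1) + ((cos \<theta>)\<^sup>2 - (sin \<theta>)\<^sup>2) * Re w) = 0"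
    unfolding A_def B_def by (simp only: sin_double cos_double) (simp add: algebra_simps)
  have "Re (real_act (rotation \<theta>) w) =
      (cos \<theta> * sin \<theta> * ((cmod w)\<^sup>2 - 1) + ((cos \<theta>)\<^sup>2 - (sin \<theta>)\<^sup>2) * Re w)
        / (cmod (cocycle (rotation \<theta>) w))\<^sup>2"
    unfolding real_act_eq Re_divide cmod_power2
    by (intro arg_cong2[where f = "(/)"])
      (auto simp: cocycle_def rotation_def algebra_simps power2_eq_square)
  with zero have "Re (real_act (rotation \<theta>) w) = 0"
    by simp
  then have w: "real_act (rotation \<theta>) w = of_real y * \<i>"
    by (simp add: complex_eq_iff y_def)
  show ?thesis
  proof (cases "y \<ge> 1")
    case True
    then show ?thesis
      using that w by blast
  next
    case False
    have "real_act (rotation (pi / 2 + \<theta>)) w = - 1 / (of_real y * \<i>)"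
      by (simp only: real_act_half_turn w flip: real_act_rotation_add[OF assms])
    also have "\<dots> = of_real (1 / y) * \<i>"
      using \<open>y > 0\<close> by (simp add: field_simps)
    finally show ?thesis
      using that[of "1 / y"] False \<open>y > 0\<close> by simp
  qed
qed

text \<open>An affine map takes $z$ to $i$ and then a rotation takes $w$ to the imaginary axis, where the
  distance is a logarithm. Unlike the infimum that defines the distance, this formula is algebraic
  in the coordinates.\<close>

lemma cosh_hyp_dist:
  assumes "Im z > 0" "Im w > 0"
  shows "cosh (hyp_dist z w) = 1 + (cmod (z - w))\<^sup>2 / (2 * Im z * Im w)"
proof -
  have vertical: "cosh (hyp_dist \<i> (of_real y * \<i>)) =
      1 + (cmod (\<i> - of_real y * \<i>))\<^sup>2 / (2 * Im \<i> * Im (of_real y * \<i>))" if "y \<ge> 1" for y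
  proof -
    have "\<i> - of_real y * \<i> = of_real (1 - y) * \<i>"
      by (simp add: algebra_simps)
    then have "(cmod (\<i> - of_real y * \<i>))\<^sup>2 = (1 - y)\<^sup>2"
      by (simp only: norm_mult norm_of_real) simp
    moreover have "cosh (hyp_dist \<i> (of_real y * \<i>)) = (y + inverse y) / 2"
      using that by (simp add: hyp_dist_vertical cosh_ln_real)
    moreover have "(y + inverse y) / 2 = 1 + (1 - y)\<^sup>2 / (2 * y)"
      using that by (simp add: field_simps power2_eq_square)
    ultimately show ?thesis
      by simp
  qed
  have from_i: "cosh (hyp_dist \<i> w) = 1 + (cmod (\<i> - w))\<^sup>2 / (2 * Im \<i> * Im w)" if w: "Im w > 0" for w
  proof -
    obtain \<theta> y where "y \<ge> 1" "real_act (rotation \<theta>) w = of_real y * \<i>"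
      using rotate_to_imaginary_axis[OF w] by blast
    then show ?thesis
      using vertical[of y] cosh_hyp_dist_real_act_iff[of "rotation \<theta>" \<i> w] w by simp
  qed
  \<comment> \<open>The map $x \mapsto (x - \mathrm{Re}\,z) / \mathrm{Im}\,z$, normalised to determinant 1.\<close>
  define M :: "real^2^2" where
    "M = vector [vector [1 / sqrt (Im z), - Re z / sqrt (Im z)], vector [0, sqrt (Im z)]]"
  have det: "det M = 1"
    using assms by (simp add: M_def det_2)
  have "of_real (sqrt (Im z)) * of_real (sqrt (Im z)) = (of_real (Im z) :: complex)"
    using assms by (simp flip: of_real_mult)
  then have "real_act M z = (z - of_real (Re z)) / of_real (Im z)"
    using assms by (simp add: M_def real_act_eq cocycle_def field_simps)
  also have "\<dots> = \<i>"
    using assms by (simp add: complex_eq_iff)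
  finally have "real_act M z = \<i>" .
  then show ?thesis
    using from_i[of "real_act M w"] Im_real_act_pos[OF det assms(2)]
      cosh_hyp_dist_real_act_iff[OF det assms] by simp
qed

section \<open>Geodesic lines through i\<close>

text \<open>The geodesic lines through $i$, by arc length, as rotated copies of the imaginary axis. The
  sign is chosen such that \<open>rotation \<theta>\<close> brings the line to the axis.\<close>

definition line_through_i :: "real \<Rightarrow> real \<Rightarrow> complex" where
  "line_through_i \<theta> t = real_act (rotation (- \<theta>)) (of_real (exp t) * \<i>)"

lemma Im_line_through_i [simp]: "Im (line_through_i \<theta> t) > 0"
  unfolding line_through_i_def by (rule Im_real_act_pos) simp_all

lemma line_through_i_zero [simp]: "line_through_i \<theta> 0 = \<i>"
  by (simp add: line_through_i_def)

text \<open>The half turn about $i$ reverses the imaginary axis and commutes with all rotations about $i$.\<close>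

lemma half_turn_line_through_i: "- 1 / line_through_i \<theta> t = line_through_i \<theta> (- t)"
proof -
  have "- 1 / (of_real (exp t) * \<i>) = of_real (exp (- t)) * \<i>"
    by (simp add: exp_minus field_simps)
  then have "line_through_i \<theta> (- t) =
      real_act (rotation (- \<theta>)) (real_act (rotation (pi / 2)) (of_real (exp t) * \<i>))"
    by (simp only: line_through_i_def real_act_half_turn)
  also have "\<dots> = real_act (rotation (pi / 2)) (line_through_i \<theta> t)"
    by (simp add: line_through_i_def real_act_rotation_add add.commute)
  finally show ?thesis
    by (simp add: real_act_half_turn)
qed

text \<open>Uniqueness of geodesics in coordinates: writing $z = u + iv$, $a = e^t$, $b = e^l$, the two
  distance conditions say $u^2 + v^2 + 1 = v(a + 1/a)$ and $u^2 + v^2 + b^2 = v(a + b^2/a)$. Their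
  difference is $b^2 - 1 = (b^2 - 1) v/a$, whence $v = a$ and then $u = 0$.\<close>

lemma point_determined_by_distances:
  assumes "l > 0" "t \<ge> 0" "Im z > 0"
    and d1: "hyp_dist \<i> z = t" and d2: "hyp_dist z (of_real (exp l) * \<i>) = \<bar>t - l\<bar>"
  shows "z = of_real (exp t) * \<i>"
proof -
  define u where "u = Re z"
  define v where "v = Im z"
  define a where "a = exp t"
  define b where "b = exp l"
  have v: "v > 0" and a: "a > 0" and b: "b > 1"
    using assms by (auto simp: v_def a_def b_def)
  have 1: "u\<^sup>2 + v\<^sup>2 + 1 = v * (a + 1 / a)"
  proof -
    have "(cmod (\<i> - z))\<^sup>2 = u\<^sup>2 + (1 - v)\<^sup>2"
      by (simp add: cmod_power2 u_def v_def)
    then have "cosh t = 1 + (u\<^sup>2 + (1 - v)\<^sup>2) / (2 * v)"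
      using cosh_hyp_dist[of \<i> z] assms by (simp add: d1 v_def)
    moreover have "2 * cosh t = a + 1 / a"
      by (simp add: cosh_def a_def exp_minus field_simps)
    ultimately show ?thesis
      using v by (simp add: field_simps power2_eq_square)
  qed
  have 2: "u\<^sup>2 + v\<^sup>2 + b\<^sup>2 = v * (a + b\<^sup>2 / a)"
  proof -
    have "(cmod (z - of_real b * \<i>))\<^sup>2 = u\<^sup>2 + (v - b)\<^sup>2"
      by (simp add: cmod_power2 u_def v_def)
    then have "cosh (t - l) = 1 + (u\<^sup>2 + (v - b)\<^sup>2) / (2 * v * b)"
      using cosh_hyp_dist[of z "of_real b * \<i>"] assms d2[folded b_def] b by (simp add: v_def)
    moreover have "2 * cosh (t - l) = a / b + b / a"
      by (simp add: cosh_def a_def b_def exp_minus exp_diff field_simps)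
    ultimately have "(a / b + b / a) * (v * b) = 2 * v * b + (u\<^sup>2 + (v - b)\<^sup>2)"
      using v b by (simp add: field_simps)
    moreover have "(a / b + b / a) * (v * b) = v * (a + b\<^sup>2 / a)"
      using a b by (simp add: field_simps power2_eq_square)
    ultimately show ?thesis
      by (simp add: power2_eq_square algebra_simps)
  qed
  have "(b\<^sup>2 - 1) * (v / a) = (b\<^sup>2 - 1) * 1"
    using 1 2 by (simp add: algebra_simps)
  moreover have "b\<^sup>2 - 1 \<noteq> 0"
    using one_less_power[OF b, of 2] by simp
  ultimately have "v / a = 1"
    using mult_left_cancel by blast
  then have "v = a"
    using a by simp
  with 1 a have "u = 0"
    by (simp add: field_simps power2_eq_square)
  with \<open>v = a\<close> show ?thesis
    by (simp add: complex_eq_iff u_def v_def a_def)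
qed

text \<open>A ray is known once one further point on it is: rotate the point at distance $l$ to the
  imaginary axis, then every other point of the ray is determined by its distances to these two.\<close>

lemma geodesic_ray_is_line_through_i:
  fixes l :: real
  assumes c: "hyp_geodesic_on {0..} c" "c 0 = \<i>" and l: "l > 0"
  obtains \<theta> where "\<And>t. t \<ge> 0 \<Longrightarrow> c t = line_through_i \<theta> t"
proof -
  have pos: "Im (c t) > 0" if "t \<ge> 0" for t
    using c(1) that unfolding hyp_geodesic_on_def upper_half_plane_def by auto
  have dist: "hyp_dist (c s) (c t) = \<bar>s - t\<bar>" if "s \<ge> 0" "t \<ge> 0" for s t
    using c(1) that unfolding hyp_geodesic_on_def by auto
  obtain \<theta> y where y: "y \<ge> 1" and cl: "real_act (rotation \<theta>) (c l) = of_real y * \<i>"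
    using rotate_to_imaginary_axis[OF pos[OF less_imp_le[OF l]]] by blast
  have inv: "hyp_dist (real_act (rotation \<theta>) (c s)) (real_act (rotation \<theta>) (c t)) = \<bar>s - t\<bar>"
    if "s \<ge> 0" "t \<ge> 0" for s t
    using hyp_dist_real_act[of "rotation \<theta>" "c s" "c t"] dist pos that by simp
  have "ln y = l"
    using inv[of 0 l] hyp_dist_vertical[of y] y l by (simp add: c(2) cl)
  then have y': "y = exp l"
    using y by (metis exp_ln less_le_trans zero_less_one)
  have "c t = line_through_i \<theta> t" if t: "t \<ge> 0" for t
  proof -
    have "real_act (rotation \<theta>) (c t) = of_real (exp t) * \<i>"
      using inv[of 0 t] inv[of t l] t l pos[of t] cl y'
      by (intro point_determined_by_distances[OF l t]) (simp_all add: c(2) Im_real_act_pos)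
    then show ?thesis
      using real_act_rotation_add[of "c t" "- \<theta>" \<theta>] pos[OF t]
      by (simp add: line_through_i_def rotation_zero)
  qed
  then show thesis
    using that by blast
qed

text \<open>Let $K$ be the rotation that brings the line to the imaginary axis and $M = KR$. Since
  $M i = e^l i$, the rows of $M$ are orthogonal and the first is $e^l$ times as long as
  the second; the determinant being 1, $M M^t = \mathrm{diag}(e^l, e^{-l})$, which
  translates the axis by $2l$. As $K$ is orthogonal, $R R^t$ is conjugate by it to $M M^t$.\<close>

lemma translation_along_line:
  assumes R: "det R = 1" and l: "real_act R \<i> = line_through_i \<theta> l"
  shows "real_act (R ** transpose R) (line_through_i \<theta> t) = line_through_i \<theta> (t + 2 * l)"
proof -
  define M where "M = rotation \<theta> ** R"
  have det: "det M = 1"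
    using R by (simp add: M_def det_mul)
  have "real_act M \<i> = real_act (rotation \<theta>) (line_through_i \<theta> l)"
    using real_act_mult[OF R, of \<i>] by (simp add: M_def l)
  also have "\<dots> = of_real (exp l) * \<i>"
    by (simp add: line_through_i_def real_act_rotation_add rotation_zero)
  finally have M: "real_act M \<i> = of_real (exp l) * \<i>" .
  have "cocycle M \<i> \<noteq> 0"
    using det by (rule cocycle_nonzero) simp
  with M have eq: "of_real (M$1$1) * \<i> + of_real (M$1$2) = of_real (exp l) * \<i> * cocycle M \<i>"
    by (simp add: real_act_eq field_simps)
  \<comment> \<open>Comparing real and imaginary parts of $ai + b = e^l i (ci + d)$.\<close>
  have b: "M$1$2 = - exp l * M$2$1" and a: "M$1$1 = exp l * M$2$2"
    using arg_cong[OF eq, of Re] arg_cong[OF eq, of Im] by (simp_all add: cocycle_def)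
  have d: "exp l * ((M$2$1)\<^sup>2 + (M$2$2)\<^sup>2) = 1"
    using det by (simp add: det_2 a b power2_eq_square algebra_simps)
  have "M ** transpose M = vector [vector [exp l, 0], vector [0, exp (- l)]]" (is "_ = ?D")
  proof -
    have "(exp l * M$2$2)\<^sup>2 + (exp l * M$2$1)\<^sup>2 = exp l * (exp l * ((M$2$1)\<^sup>2 + (M$2$2)\<^sup>2))"
      by (simp add: power2_eq_square algebra_simps)
    moreover have "(M$2$1)\<^sup>2 + (M$2$2)\<^sup>2 = exp (- l)"
      using d by (simp add: exp_minus field_simps)
    ultimately show ?thesis
      using d by (simp add: vec_eq_iff forall_2 matrix_matrix_mult_def transpose_def sum_2 a b)
        (simp add: power2_eq_square algebra_simps)
  qed
  moreover have "rotation (- \<theta>) ** (M ** transpose M) =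
      (rotation (- \<theta>) ** rotation \<theta>) ** (R ** transpose R) ** rotation (- \<theta>)"
    by (simp add: M_def matrix_transpose_mul transpose_rotation matrix_mul_assoc)
  ultimately have conj: "(R ** transpose R) ** rotation (- \<theta>) = rotation (- \<theta>) ** ?D"
    by (simp add: rotation_add rotation_zero)
  have detD: "det ?D = 1"
    by (simp add: det_2 flip: exp_add)
  have D: "real_act ?D (of_real (exp t) * \<i>) = of_real (exp (t + 2 * l)) * \<i>"
  proof -
    have "exp (t + 2 * l) = exp l * exp t / exp (- l)"
      by (simp flip: exp_add exp_diff)
    then show ?thesis
      by (simp add: real_act_eq cocycle_def)
  qed
  have "real_act (R ** transpose R) (line_through_i \<theta> t)
      = real_act ((R ** transpose R) ** rotation (- \<theta>)) (of_real (exp t) * \<i>)"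
    by (simp add: line_through_i_def real_act_mult)
  also have "\<dots> = real_act (rotation (- \<theta>)) (real_act ?D (of_real (exp t) * \<i>))"
    unfolding conj using detD by (intro real_act_mult) simp_all
  also have "\<dots> = line_through_i \<theta> (t + 2 * l)"
    by (simp only: D line_through_i_def)
  finally show ?thesis .
qed

section \<open>The orbit of i under the modular group\<close>

definition real_matrix :: "int^2^2 \<Rightarrow> real^2^2" where
  "real_matrix = map_matrix of_int"

lemma act_eq_real_act: "act \<gamma> = real_act (real_matrix \<gamma>)"
  by (simp add: act_def real_act_def real_matrix_def)

lemma det_real_matrix:
  assumes "\<gamma> \<in> SL2Z"
  shows "det (real_matrix \<gamma>) = 1"
proof -
  have "det (real_matrix \<gamma>) = of_int (det \<gamma>)"
    by (simp add: real_matrix_def det_2)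
  then show ?thesis
    using assms by (simp add: SL2Z_def)
qed

lemma real_matrix_mult: "real_matrix (A ** B) = real_matrix A ** real_matrix B"
  by (simp add: real_matrix_def vec_eq_iff matrix_matrix_mult_def)

lemma real_matrix_transpose: "real_matrix (transpose A) = transpose (real_matrix A)"
  by (simp add: real_matrix_def vec_eq_iff transpose_def)

lemma SL2Z_mult: "A \<in> SL2Z \<Longrightarrow> B \<in> SL2Z \<Longrightarrow> A ** B \<in> SL2Z"
  by (simp add: SL2Z_def det_mul)

lemma SL2Z_transpose: "A \<in> SL2Z \<Longrightarrow> transpose A \<in> SL2Z"
  by (simp add: SL2Z_def)

lemma SL2Z_matrix_pow: "A \<in> SL2Z \<Longrightarrow> matrix_pow A n \<in> SL2Z"
  by (induction n) (auto simp: SL2Z_mult, simp add: SL2Z_def)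

lemma act_mult:
  assumes "B \<in> SL2Z" "Im z > 0"
  shows "act (A ** B) z = act A (act B z)"
  using assms by (simp add: act_eq_real_act real_matrix_mult real_act_mult det_real_matrix)

lemma orbit_i_act:
  assumes "z \<in> orbit_i" "\<gamma> \<in> SL2Z"
  shows "act \<gamma> z \<in> orbit_i"
proof -
  obtain \<delta> where \<delta>: "\<delta> \<in> SL2Z" "z = act \<delta> \<i>"
    using assms(1) by (auto simp: orbit_i_def)
  then have "act \<gamma> z = act (\<gamma> ** \<delta>) \<i>"
    by (simp add: act_mult)
  then show ?thesis
    using SL2Z_mult[OF assms(2) \<delta>(1)] by (auto simp: orbit_i_def)
qed

lemma i_in_orbit_i: "\<i> \<in> orbit_i"
proof -
  have "act (mat 1) \<i> = \<i>"
    by (simp add: act_def moebius_def mat_def)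
  moreover have "mat 1 \<in> SL2Z"
    by (simp add: SL2Z_def)
  ultimately show ?thesis
    unfolding orbit_i_def by (auto intro!: exI[of _ "mat 1"])
qed

lemma orbit_i_half_turn:
  assumes "z \<in> orbit_i"
  shows "- 1 / z \<in> orbit_i"
proof -
  define S :: "int^2^2" where "S = vector [vector [0, - 1], vector [1, 0]]"
  have "S \<in> SL2Z" "act S z = - 1 / z"
    by (simp_all add: S_def SL2Z_def det_2 act_def moebius_def)
  then show ?thesis
    using orbit_i_act[OF assms] by metis
qed

definition entry_square_sum :: "int^2^2 \<Rightarrow> int" where
  "entry_square_sum \<gamma> = (\<gamma>$1$1)\<^sup>2 + (\<gamma>$1$2)\<^sup>2 + (\<gamma>$2$1)\<^sup>2 + (\<gamma>$2$2)\<^sup>2"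

text \<open>This makes the orbit discrete: the hyperbolic cosines of the distances from $i$ are half-integers,
  so any nonempty set of orbit points has one that is closest to $i$.\<close>

lemma cosh_hyp_dist_act:
  assumes "\<gamma> \<in> SL2Z"
  shows "cosh (hyp_dist \<i> (act \<gamma> \<i>)) = of_int (entry_square_sum \<gamma>) / 2"
proof -
  define a b c d :: real where abcd: "a = of_int (\<gamma>$1$1)" "b = of_int (\<gamma>$1$2)"
    "c = of_int (\<gamma>$2$1)" "d = of_int (\<gamma>$2$2)"
  define M where "M = real_matrix \<gamma>"
  define q where "q = c\<^sup>2 + d\<^sup>2"
  have det: "det M = 1"
    using det_real_matrix[OF assms] by (simp add: M_def)
  have co: "cocycle M \<i> = Complex d c"
    by (simp add: cocycle_def M_def real_matrix_def abcd complex_eq_iff)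
  have "(cmod (cocycle M \<i>))\<^sup>2 = q"
    by (simp add: co cmod_power2 q_def)
  moreover have "cocycle M \<i> \<noteq> 0"
    using det by (rule cocycle_nonzero) simp
  ultimately have q: "q > 0"
    by (metis zero_less_norm_iff zero_less_power)
  have Im: "Im (act \<gamma> \<i>) = 1 / q"
    using Im_real_act[OF det, of \<i>] \<open>(cmod (cocycle M \<i>))\<^sup>2 = q\<close>
    by (simp add: act_eq_real_act flip: M_def)
  have "act \<gamma> \<i> = Complex b a / Complex d c"
    by (simp add: act_eq_real_act real_act_eq co flip: M_def)
      (simp add: M_def real_matrix_def abcd complex_eq_iff)
  then have "(cmod (act \<gamma> \<i>))\<^sup>2 = (a\<^sup>2 + b\<^sup>2) / q"
    by (simp add: norm_divide power_divide cmod_power2 q_def add.commute)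
  moreover have "(cmod (\<i> - act \<gamma> \<i>))\<^sup>2 = (cmod (act \<gamma> \<i>))\<^sup>2 - 2 * Im (act \<gamma> \<i>) + 1"
    by (simp add: cmod_power2 power2_diff)
  ultimately have "cosh (hyp_dist \<i> (act \<gamma> \<i>)) = 1 + ((a\<^sup>2 + b\<^sup>2) / q - 2 / q + 1) / (2 / q)"
    using q cosh_hyp_dist[of \<i> "act \<gamma> \<i>"] by (simp add: Im)
  also have "\<dots> = (a\<^sup>2 + b\<^sup>2 + q) / 2"
    using q by (simp add: field_simps)
  finally show ?thesis
    by (simp add: q_def abcd entry_square_sum_def)
qed

section \<open>Orbit points on a line\<close>

text \<open>Shifting an element by the nearest multiple of $2l$ brings it into $[-l, l]$. By minimality
  of $l$ and symmetry under negation the only elements there are $-l$, $0$ and $l$.\<close>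

lemma multiples_of_least_positive:
  fixes T :: "real set"
  assumes l: "l > 0" "0 \<in> T" "l \<in> T"
    and neg: "\<And>t. t \<in> T \<Longrightarrow> - t \<in> T"
    and shift: "\<And>t. t \<in> T \<Longrightarrow> t + 2 * l \<in> T"
    and least: "\<And>t. t \<in> T \<Longrightarrow> t > 0 \<Longrightarrow> l \<le> t"
  shows "T = range (\<lambda>n::int. of_int n * l)"
proof -
  have nat_shift: "t + of_nat n * (2 * l) \<in> T" if "t \<in> T" for t n
    using that by (induction n) (auto simp: algebra_simps dest: shift)
  have int_shift: "t + of_int m * (2 * l) \<in> T" if "t \<in> T" for t m
  proof (cases "m \<ge> 0")
    case True
    then show ?thesis
      using nat_shift[OF that, of "nat m"] by simp
  next
    case False
    then show ?thesis
      using neg[OF nat_shift[OF neg[OF that], of "nat (- m)"]] by (simp add: add.commute)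
  qed
  show ?thesis
  proof (intro equalityI subsetI)
    fix t assume t: "t \<in> T"
    define m where "m = round (t / (2 * l))"
    define s where "s = t - of_int m * (2 * l)"
    have s: "s \<in> T"
      using int_shift[OF t, of "- m"] by (simp add: s_def)
    have "\<bar>of_int m - t / (2 * l)\<bar> \<le> 1 / 2"
      unfolding m_def by (rule of_int_round_abs_le)
    then have "\<bar>of_int m - t / (2 * l)\<bar> * (2 * l) \<le> 1 / 2 * (2 * l)"
      using l by (intro mult_right_mono) simp_all
    moreover have "\<bar>of_int m - t / (2 * l)\<bar> * (2 * l) = \<bar>(of_int m - t / (2 * l)) * (2 * l)\<bar>"
      using l by (simp add: abs_mult)
    moreover have "(of_int m - t / (2 * l)) * (2 * l) = - s"
      using l by (simp add: s_def field_simps)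
    ultimately have "\<bar>s\<bar> \<le> l"
      by simp
    with least[OF s] least[OF neg[OF s]] have "s = 0 \<or> s = l \<or> s = - l"
      by linarith
    then have "t = of_int (2 * m) * l \<or> t = of_int (2 * m + 1) * l \<or> t = of_int (2 * m - 1) * l"
      by (auto simp: s_def algebra_simps)
    then show "t \<in> range (\<lambda>n::int. of_int n * l)"
      by blast
  next
    fix t assume "t \<in> range (\<lambda>n::int. of_int n * l)"
    then obtain n :: int where n: "t = of_int n * l"
      by blast
    show "t \<in> T"
    proof (cases "even n")
      case True
      then show ?thesis
        using int_shift[OF l(2)] by (auto simp: n elim!: evenE) (metis mult.assoc mult.commute)
    next
      case False
      then obtain k where "n = 2 * k + 1"
        by (rule oddE)
      then show ?thesis
        using int_shift[OF l(3), of k] by (simp add: n algebra_simps)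
    qed
  qed
qed

lemma act_translation_along_line:
  assumes \<gamma>: "\<gamma> \<in> SL2Z" and l: "act \<gamma> \<i> = line_through_i \<theta> l"
  shows "act (matrix_pow (\<gamma> ** transpose \<gamma>) n) (line_through_i \<theta> t) = line_through_i \<theta> (t + 2 * n * l)"
proof (induction n)
  case 0
  then show ?case
    by (simp add: act_def moebius_def mat_def)
next
  case (Suc n)
  let ?P = "\<gamma> ** transpose \<gamma>"
  have "matrix_pow ?P n \<in> SL2Z"
    using \<gamma> by (intro SL2Z_matrix_pow SL2Z_mult SL2Z_transpose)
  then have "act (matrix_pow ?P (Suc n)) (line_through_i \<theta> t) =
      act ?P (line_through_i \<theta> (t + 2 * n * l))"
    by (simp add: act_mult Suc.IH)
  also have "\<dots> = line_through_i \<theta> (t + 2 * n * l + 2 * l)"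
    using translation_along_line[OF det_real_matrix[OF \<gamma>]] l
    by (simp add: act_eq_real_act real_matrix_mult real_matrix_transpose)
  finally show ?case
    by (simp add: algebra_simps)
qed

text \<open>The positions of the orbit points on the line are closed under negation, because of the half turn
  about $i$, and under translation by $2l$, because of $\gamma\gamma^t$.\<close>

lemma orbit_points_on_line_are_multiples:
  assumes \<gamma>: "\<gamma> \<in> SL2Z" and l: "act \<gamma> \<i> = line_through_i \<theta> l" "l > 0"
    and least: "\<And>t. t > 0 \<Longrightarrow> line_through_i \<theta> t \<in> orbit_i \<Longrightarrow> l \<le> t"
  shows "{t. line_through_i \<theta> t \<in> orbit_i} = range (\<lambda>n::int. of_int n * l)"
proof (rule multiples_of_least_positive)
  show "l \<in> {t. line_through_i \<theta> t \<in> orbit_i}"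
    using \<gamma> by (auto simp: orbit_i_def simp flip: l(1))
  have "line_through_i \<theta> (t + 2 * l) \<in> orbit_i" if "line_through_i \<theta> t \<in> orbit_i" for t
  proof -
    have "matrix_pow (\<gamma> ** transpose \<gamma>) 1 \<in> SL2Z"
      using \<gamma> by (intro SL2Z_matrix_pow SL2Z_mult SL2Z_transpose)
    then show ?thesis
      using orbit_i_act[OF that, of "matrix_pow (\<gamma> ** transpose \<gamma>) 1"]
        act_translation_along_line[OF \<gamma> l(1), of 1 t] by simp
  qed
  then show "t + 2 * l \<in> {t. line_through_i \<theta> t \<in> orbit_i}"
    if "t \<in> {t. line_through_i \<theta> t \<in> orbit_i}" for t
    using that by simp
qed (use l least orbit_i_half_turn in \<open>auto simp: i_in_orbit_i simp flip: half_turn_line_through_i\<close>)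

section \<open>Rays through orbit points\<close>

theorem proposition3p1:
  fixes r :: "complex set"
  assumes "geodesic_ray_from \<i> r"
    and "\<exists>z \<in> r \<inter> orbit_i. z \<noteq> \<i>"
  shows "(\<exists>\<gamma> \<in> SL2Z.
            r \<inter> (orbit_i - {\<i>}) =
              {act (matrix_pow (\<gamma> ** transpose \<gamma>) (n - 1) ** \<gamma>) \<i> | n :: nat. 1 \<le> n} \<union>
              {act (matrix_pow (\<gamma> ** transpose \<gamma>) n) \<i> | n :: nat. 1 \<le> n}
            \<and> visible (act \<gamma> \<i>))
         \<and> equally_spaced (r \<inter> orbit_i)"
proof -
  obtain c where c: "hyp_geodesic_on {0..} c" "c 0 = \<i>" and r: "r = c ` {0..}"
    using assms(1) by (auto simp: geodesic_ray_from_def)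
  have dist: "hyp_dist (c s) (c t) = \<bar>s - t\<bar>" if "s \<ge> 0" "t \<ge> 0" for s t
    using c(1) that unfolding hyp_geodesic_on_def by auto
  have c_eq_i: "t = 0" if "t \<ge> 0" "c t = \<i>" for t
    using dist[of 0 t] dist[of 0 0] that c(2) by simp
  \<comment> \<open>Choose $\gamma$ so that $\gamma(i)$ is the orbit point on the ray that is closest to $i$.\<close>
  define P where "P = (\<lambda>\<gamma>. \<gamma> \<in> SL2Z \<and> act \<gamma> \<i> \<in> r \<and> act \<gamma> \<i> \<noteq> \<i>)"
  have "\<exists>\<gamma>. P \<gamma>"
    using assms(2) by (auto simp: P_def orbit_i_def)
  then obtain \<gamma> where "P \<gamma>" and
    min: "\<And>\<delta>. P \<delta> \<Longrightarrow> nat (entry_square_sum \<gamma>) \<le> nat (entry_square_sum \<delta>)"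
    using ex_has_least_nat[of P _ "\<lambda>\<gamma>. nat (entry_square_sum \<gamma>)"] by blast
  then have \<gamma>: "\<gamma> \<in> SL2Z" "act \<gamma> \<i> \<in> r" "act \<gamma> \<i> \<noteq> \<i>"
    by (auto simp: P_def)
  obtain l where l: "l \<ge> 0" "act \<gamma> \<i> = c l"
    using \<gamma>(2) r by auto
  with \<gamma>(3) c(2) have "l > 0"
    by (cases "l = 0") auto
  have least: "l \<le> t" if t: "t > 0" "c t \<in> orbit_i" for t
  proof -
    obtain \<delta> where \<delta>: "\<delta> \<in> SL2Z" "c t = act \<delta> \<i>"
      using t(2) by (auto simp: orbit_i_def)
    moreover have "c t \<noteq> \<i>" "c t \<in> r"
      using c_eq_i[of t] t(1) r by auto
    ultimately have "P \<delta>"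
      by (simp add: P_def)
    then have "nat (entry_square_sum \<gamma>) \<le> nat (entry_square_sum \<delta>)"
      by (rule min)
    moreover have "entry_square_sum \<delta> \<ge> 0"
      by (simp add: entry_square_sum_def)
    ultimately have "entry_square_sum \<gamma> \<le> entry_square_sum \<delta>"
      by linarith
    then have "cosh (hyp_dist \<i> (act \<gamma> \<i>)) \<le> cosh (hyp_dist \<i> (act \<delta> \<i>))"
      by (simp add: cosh_hyp_dist_act \<gamma> \<delta>)
    then have "cosh l \<le> cosh t"
      using dist[of 0 l] dist[of 0 t] t(1) \<open>l > 0\<close> by (simp add: c(2) \<delta>(2) l(2))
    then show ?thesis
      using cosh_real_nonneg_le_iff[of l t] t(1) \<open>l > 0\<close> by simp
  qed
  obtain \<theta> where \<theta>: "\<And>t. t \<ge> 0 \<Longrightarrow> c t = line_through_i \<theta> t"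
    using geodesic_ray_is_line_through_i[OF c \<open>l > 0\<close>] by blast
  have \<gamma>_line: "act \<gamma> \<i> = line_through_i \<theta> l"
    using l \<theta> by simp
  have "{t. line_through_i \<theta> t \<in> orbit_i} = range (\<lambda>n::int. of_int n * l)"
    using \<open>l > 0\<close> least \<theta> by (intro orbit_points_on_line_are_multiples[OF \<gamma>(1) \<gamma>_line]) auto
  then have in_orbit: "c t \<in> orbit_i \<longleftrightarrow> (\<exists>n::int. t = of_int n * l)" if "t \<ge> 0" for t
    using \<theta>[OF that] by auto
  have orbit_iff: "c t \<in> orbit_i \<longleftrightarrow> (\<exists>n::nat. t = of_nat n * l)" if "t \<ge> 0" for t
  proof
    assume "c t \<in> orbit_i"
    then obtain n :: int where n: "t = of_int n * l"
      using in_orbit \<open>t \<ge> 0\<close> by blast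
    with that \<open>l > 0\<close> have "n \<ge> 0"
      by (simp add: zero_le_mult_iff)
    then show "\<exists>n::nat. t = of_nat n * l"
      using n by (intro exI[of _ "nat n"]) simp
  next
    assume "\<exists>n::nat. t = of_nat n * l"
    then obtain n :: nat where "t = of_nat n * l"
      by blast
    then have "t = of_int (int n) * l"
      by simp
    then show "c t \<in> orbit_i"
      using in_orbit[OF that] by blast
  qed
  have r_orbit: "r \<inter> orbit_i = range (\<lambda>n::nat. c (of_nat n * l))"
  proof (intro equalityI subsetI)
    fix z assume "z \<in> r \<inter> orbit_i"
    then obtain t where "t \<ge> 0" "z = c t" "c t \<in> orbit_i"
      by (auto simp: r)
    then show "z \<in> range (\<lambda>n::nat. c (of_nat n * l))"
      using orbit_iff by blast
  next
    fix z assume "z \<in> range (\<lambda>n::nat. c (of_nat n * l))"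
    then obtain n :: nat where z: "z = c (of_nat n * l)"
      by blast
    have "of_nat n * l \<ge> 0"
      using \<open>l > 0\<close> by simp
    then show "z \<in> r \<inter> orbit_i"
      using orbit_iff by (auto simp only: z r Int_iff intro: image_eqI)
  qed
  \<comment> \<open>The translation by $2l$ reaches the even multiples of $l$ from $i$ and the odd ones from
    $\gamma(i)$.\<close>
  have odd: "act (matrix_pow (\<gamma> ** transpose \<gamma>) (n - 1) ** \<gamma>) \<i> = c (of_nat (2 * n - 1) * l)"
    if "1 \<le> n" for n
  proof -
    have "act (matrix_pow (\<gamma> ** transpose \<gamma>) (n - 1) ** \<gamma>) \<i> =
        line_through_i \<theta> (l + 2 * of_nat (n - 1) * l)"
      using act_translation_along_line[OF \<gamma>(1) \<gamma>_line, of "n - 1" l]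
      by (simp add: act_mult \<gamma>(1) \<gamma>_line)
    also have "l + 2 * of_nat (n - 1) * l = of_nat (2 * n - 1) * l"
      using that by (simp add: of_nat_diff algebra_simps)
    also have "line_through_i \<theta> (of_nat (2 * n - 1) * l) = c (of_nat (2 * n - 1) * l)"
      using \<theta>[of "of_nat (2 * n - 1) * l"] \<open>l > 0\<close> by simp
    finally show ?thesis .
  qed
  have even: "act (matrix_pow (\<gamma> ** transpose \<gamma>) n) \<i> = c (of_nat (2 * n) * l)" for n
    using act_translation_along_line[OF \<gamma>(1) \<gamma>_line, of n 0] \<theta>[of "of_nat (2 * n) * l"] \<open>l > 0\<close> by simp
  have nonzero: "c (of_nat n * l) \<noteq> \<i>" if "n > 0" for n
    using c_eq_i[of "of_nat n * l"] that \<open>l > 0\<close> by auto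
  have "r \<inter> (orbit_i - {\<i>}) =
      {act (matrix_pow (\<gamma> ** transpose \<gamma>) (n - 1) ** \<gamma>) \<i> | n :: nat. 1 \<le> n} \<union>
      {act (matrix_pow (\<gamma> ** transpose \<gamma>) n) \<i> | n :: nat. 1 \<le> n}" (is "_ = ?R")
  proof (intro equalityI subsetI)
    fix z assume "z \<in> r \<inter> (orbit_i - {\<i>})"
    then have "z \<in> range (\<lambda>n::nat. c (of_nat n * l))" and "z \<noteq> \<i>"
      unfolding r_orbit[symmetric] by simp_all
    then obtain m :: nat where m: "z = c (of_nat m * l)" and "z \<noteq> \<i>"
      by blast
    then have "m > 0"
      using c(2) by (cases m) auto
    show "z \<in> ?R"
    proof (cases "even m")
      case True
      then obtain n where n: "m = 2 * n"
        by (rule evenE)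
      then have "z = act (matrix_pow (\<gamma> ** transpose \<gamma>) n) \<i>"
        using m by (simp only: even)
      moreover have "1 \<le> n"
        using n \<open>m > 0\<close> by simp
      ultimately show ?thesis
        by blast
    next
      case False
      then obtain n where n: "m = 2 * n + 1"
        by (rule oddE)
      then have "m = 2 * Suc n - 1"
        by simp
      then have "z = act (matrix_pow (\<gamma> ** transpose \<gamma>) (Suc n - 1) ** \<gamma>) \<i>"
        using m odd[of "Suc n"] by (simp only: le_add1 One_nat_def Suc_le_mono le0)
      moreover have "1 \<le> Suc n"
        by simp
      ultimately show ?thesis
        by blast
    qed
  next
    fix z assume "z \<in> ?R"
    then obtain m :: nat where m: "z = c (of_nat m * l)" "m > 0"
    proof
      assume "z \<in> {act (matrix_pow (\<gamma> ** transpose \<gamma>) (n - 1) ** \<gamma>) \<i> | n :: nat. 1 \<le> n}"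
      then obtain n :: nat where n: "1 \<le> n" "z = act (matrix_pow (\<gamma> ** transpose \<gamma>) (n - 1) ** \<gamma>) \<i>"
        by blast
      then have "z = c (of_nat (2 * n - 1) * l)"
        by (simp only: odd)
      moreover have "2 * n - 1 > 0"
        using n(1) by simp
      ultimately show ?thesis
        by (rule that)
    next
      assume "z \<in> {act (matrix_pow (\<gamma> ** transpose \<gamma>) n) \<i> | n :: nat. 1 \<le> n}"
      then obtain n :: nat where n: "1 \<le> n" "z = act (matrix_pow (\<gamma> ** transpose \<gamma>) n) \<i>"
        by blast
      then have "z = c (of_nat (2 * n) * l)"
        by (simp only: even)
      moreover have "2 * n > 0"
        using n(1) by simp
      ultimately show ?thesis
        by (rule that)
    qed
    then have "z \<in> r \<inter> orbit_i" "z \<noteq> \<i>"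
      unfolding r_orbit using nonzero[of m] by simp_all
    then show "z \<in> r \<inter> (orbit_i - {\<i>})"
      by blast
  qed
  moreover have "visible (act \<gamma> \<i>)"
  proof -
    have "geodesic_arc \<i> (act \<gamma> \<i>) (c ` {0..l})"
      using c l unfolding geodesic_arc_def hyp_geodesic_on_def by (intro exI[of _ c] exI[of _ l]) auto
    moreover have "c ` {0..l} \<inter> orbit_i = {\<i>, act \<gamma> \<i>}"
    proof
      show "c ` {0..l} \<inter> orbit_i \<subseteq> {\<i>, act \<gamma> \<i>}"
      proof
        fix z assume "z \<in> c ` {0..l} \<inter> orbit_i"
        then obtain t where t: "0 \<le> t" "t \<le> l" "z = c t" "c t \<in> orbit_i"
          by auto
        then have "t = 0 \<or> t = l"
          using least[of t] by linarith
        then show "z \<in> {\<i>, act \<gamma> \<i>}"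
          using t(3) c(2) l(2) by auto
      qed
      have "\<i> \<in> c ` {0..l}" "act \<gamma> \<i> \<in> c ` {0..l}"
        using c(2) l by (auto intro: image_eqI[of _ _ 0])
      then show "{\<i>, act \<gamma> \<i>} \<subseteq> c ` {0..l} \<inter> orbit_i"
        using \<gamma>(1) i_in_orbit_i by (auto simp: orbit_i_def)
    qed
    moreover have "act \<gamma> \<i> \<in> orbit_i"
      using \<gamma>(1) by (auto simp: orbit_i_def)
    ultimately show ?thesis
      using \<gamma>(3) unfolding visible_def by blast
  qed
  moreover have "equally_spaced (r \<inter> orbit_i)"
  proof -
    have "hyp_dist (c (of_nat m * l)) (c (of_nat n * l)) = \<bar>real m - real n\<bar> * l" for m n
    proof -
      have "of_nat m * l - of_nat n * l = (real m - real n) * l"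
        by (simp add: left_diff_distrib)
      then have "\<bar>of_nat m * l - of_nat n * l\<bar> = \<bar>real m - real n\<bar> * l"
        using \<open>l > 0\<close> by (simp only: abs_mult)
      then show ?thesis
        using dist[of "of_nat m * l" "of_nat n * l"] \<open>l > 0\<close> by simp
    qed
    then show ?thesis
      unfolding equally_spaced_def r_orbit using \<open>l > 0\<close>
      by (intro exI[of _ l] conjI exI[of _ "\<lambda>n. c (of_nat n * l)"]) auto
  qed
  ultimately show ?thesis
    using \<gamma>(1) by blast
qed

end
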